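(* Let $f_1,\dots,f_m:\mathbb{R}^d\to\mathbb{R}$ each be $\mu$-strongly convex and $L$-smooth with $\mu>0$, let $\kappa=L/\mu$, and let $x^\star$ be the solution of $\min_{x\in\mathbb{R}^d}\frac1m\sum_{i=1}^m f_i(x)$. Let $A\in\mathbb{R}^{m\times m}$, $B,C\in\mathbb{S}^m$ and $\gamma$ satisfy: (i) $A=BD$ with $D\in\mathbb{S}^m$, $0\prec D\preceq I$; (ii) $1^\top D1=m$ and $1^\top B=1^\top$; (iii) $0\preceq C\prec I$ and $\mathrm{Null}(C)=\mathrm{span}(1)$; (iv) $B$ and $C$ commute; (v) $q(D,\gamma)^2AB\prec I-C$ and $0<\gamma\le\gamma^\star(D)$, where $$\gamma^\star(D)=\frac{2\lambda_{\min}(D)}{L+\mu\lambda_{\min}(D)},\qquad q(D,\gamma)=\sqrt{1-\frac{2\gamma L}{\kappa+\lambda_{\min}(D)}}.$$ Let $X^0\in\mathbb{R}^{m\times d}$ be arbitrary, $Y^0=0$, and for $k\ge0$ $$X^{k+1}=AX^k-\gamma B\nabla f(X^k)-Y^k,\qquad Y^{k+1}=Y^k+CX^{k+1}.$$ Then $\|X^k-1x^{\star\top}\|^2=\mathcal{O}(\delta^k)$ with $$\delta=\max\Big(q(D,\gamma)^2\,\lambda_{\max}\big(AB(I-C)^{-1}\big),\;1-\lambda_2(C)\Big).$$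
   Context: $\mathbb{S}^m$ is the set of real symmetric $m\times m$ matrices; $\preceq,\prec$ denote the Loewner order. $1\in\mathbb{R}^m$ is the all-ones vector. For $X=[x_1,\dots,x_m]^\top\in\mathbb{R}^{m\times d}$ (row $i$ is $x_i^\top$), $f(X)=\sum_{i=1}^m f_i(x_i)$ and $\nabla f(X)=[\nabla f_1(x_1),\dots,\nabla f_m(x_m)]^\top\in\mathbb{R}^{m\times d}$. "$L$-smooth" means differentiable with $L$-Lipschitz gradient. $\|\cdot\|$ is the Frobenius norm. $\lambda_{\min},\lambda_{\max}$ are the smallest and largest eigenvalues and $\lambda_2(C)$ is the second smallest eigenvalue of $C$. ($AB=BDB$ is symmetric, and the eigenvalues of $AB(I-C)^{-1}$ are real.) *)

theory Defs
  imports "HOL-Analysis.Analysis" "HOL-Library.Landau_Symbols"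
begin

definition strongly_convex :: "real \<Rightarrow> ('a::real_inner \<Rightarrow> real) \<Rightarrow> bool" where
  "strongly_convex \<mu> f \<longleftrightarrow>
     (\<forall>x y t. 0 \<le> t \<and> t \<le> 1 \<longrightarrow>
        f ((1 - t) *\<^sub>R x + t *\<^sub>R y)
          \<le> (1 - t) * f x + t * f y - \<mu> / 2 * t * (1 - t) * (norm (x - y))\<^sup>2)"

definition gradient :: "('a::real_inner \<Rightarrow> real) \<Rightarrow> 'a \<Rightarrow> 'a" where
  "gradient f x = (THE g. GDERIV f x :> g)"

definition smooth_with :: "real \<Rightarrow> ('a::euclidean_space \<Rightarrow> real) \<Rightarrow> bool" where
  "smooth_with L f \<longleftrightarrow> (\<forall>x. f differentiable (at x)) \<and> L-lipschitz_on UNIV (gradient f)"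

text \<open>A matrix \<open>X\<close> whose rows are points of \<open>\<real>\<^sup>d\<close> has type \<open>real ^ 'd ^ 'm\<close>, with \<open>X $ i\<close> its
  \<open>i\<close>-th row. The library norm of this type is the Euclidean norm of the Euclidean norms of the
  rows, that is, the Frobenius norm. The constant \<open>1 :: real ^ 'm\<close> is the all-ones vector; at the
  matrix type \<open>1\<close> would be the all-ones matrix, so the identity is always \<open>mat 1\<close>.\<close>

definition stacked_gradient :: "('m \<Rightarrow> real ^ 'd \<Rightarrow> real) \<Rightarrow> real ^ 'd ^ 'm \<Rightarrow> real ^ 'd ^ 'm" where
  "stacked_gradient f X = (\<chi> i. gradient (f i) (X $ i))"

definition outer :: "real ^ 'm \<Rightarrow> real ^ 'd \<Rightarrow> real ^ 'd ^ 'm" where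
  "outer u v = (\<chi> i j. u $ i * v $ j)"

definition symmetric :: "real ^ 'm ^ 'm \<Rightarrow> bool" where
  "symmetric A \<longleftrightarrow> transpose A = A"

definition loewner_le :: "real ^ 'm ^ 'm \<Rightarrow> real ^ 'm ^ 'm \<Rightarrow> bool" (infix \<open>\<preceq>\<close> 50) where
  "A \<preceq> B \<longleftrightarrow> symmetric A \<and> symmetric B \<and> (\<forall>v. 0 \<le> v \<bullet> ((B - A) *v v))"

definition loewner_less :: "real ^ 'm ^ 'm \<Rightarrow> real ^ 'm ^ 'm \<Rightarrow> bool" (infix \<open>\<prec>\<close> 50) where
  "A \<prec> B \<longleftrightarrow> symmetric A \<and> symmetric B \<and> (\<forall>v. v \<noteq> 0 \<longrightarrow> 0 < v \<bullet> ((B - A) *v v))"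

definition null_space :: "real ^ 'm ^ 'm \<Rightarrow> (real ^ 'm) set" where
  "null_space A = {v. A *v v = 0}"

definition eigenspace :: "real ^ 'm ^ 'm \<Rightarrow> real \<Rightarrow> (real ^ 'm) set" where
  "eigenspace A l = {v. A *v v = l *\<^sub>R v}"

definition eigenvalues :: "real ^ 'm ^ 'm \<Rightarrow> real set" where
  "eigenvalues A = {l. \<exists>v. v \<noteq> 0 \<and> A *v v = l *\<^sub>R v}"

definition lambda_min :: "real ^ 'm ^ 'm \<Rightarrow> real" where
  "lambda_min A = Min (eigenvalues A)"

definition lambda_max :: "real ^ 'm ^ 'm \<Rightarrow> real" where
  "lambda_max A = Max (eigenvalues A)"

text \<open>The eigenvalues in increasing order, each repeated according to its geometric multiplicity.
  For a symmetric matrix this is the algebraic multiplicity, so the list has length \<open>CARD('m)\<close>.\<close>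

definition eigenvalue_list :: "real ^ 'm ^ 'm \<Rightarrow> real list" where
  "eigenvalue_list A =
     sorted_list_of_multiset (\<Sum>l\<in>eigenvalues A. replicate_mset (dim (eigenspace A l)) l)"

text \<open>List positions count from 0. The value is meaningful only if \<open>CARD('m) \<ge> 2\<close>.\<close>

definition lambda_2 :: "real ^ 'm ^ 'm \<Rightarrow> real" where
  "lambda_2 A = eigenvalue_list A ! 1"

definition gamma_star :: "real \<Rightarrow> real \<Rightarrow> real ^ 'm ^ 'm \<Rightarrow> real" where
  "gamma_star L \<mu> D = 2 * lambda_min D / (L + \<mu> * lambda_min D)"

definition q_factor :: "real \<Rightarrow> real \<Rightarrow> real ^ 'm ^ 'm \<Rightarrow> real \<Rightarrow> real" where
  "q_factor L \<mu> D \<gamma> = (let \<kappa> = L / \<mu> in sqrt (1 - 2 * \<gamma> * L / (\<kappa> + lambda_min D)))"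

end

theory Submission
  imports Defs
begin

text \<open>
  Put \<open>W = D (X - X\<^sub>\<star>) - \<gamma> (\<nabla>f(X) - \<nabla>f(X\<^sub>\<star>))\<close> with \<open>X\<^sub>\<star> = 1 x\<^sub>\<star>\<^sup>T\<close>. Since \<open>\<lambda> I \<preceq> D \<preceq> I\<close> for
  \<open>\<lambda> = \<lambda>\<^sub>m\<^sub>i\<^sub>n(D)\<close>, the function \<open>f\<close> is \<open>\<mu>\<close>-strongly convex and \<open>L/\<lambda>\<close>-smooth in the norm of \<open>D\<close>, and
  \<open>W\<close> is \<open>D\<close> applied to a gradient step in this norm; hence
  \<open>\<parallel>W\<parallel>\<^sup>2 \<le> \<langle>W, D\<^sup>-\<^sup>1 W\<rangle> \<le> q\<^sup>2 \<langle>X - X\<^sub>\<star>, D (X - X\<^sub>\<star>)\<rangle>\<close>.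

  The columns of \<open>\<nabla>f(X\<^sub>\<star>)\<close> are orthogonal to \<open>1\<close>, hence in the range of \<open>C\<close>. As \<open>B\<close> and \<open>C\<close> commute,
  the errors take the form \<open>X - X\<^sub>\<star> = B P\<close> and \<open>Y - Y\<^sub>\<star> = B C Q\<close>, where the iteration reads
  \<open>P' = W - C Q\<close> and \<open>Q' = Q + P'\<close>. Therefore
  \<open>\<langle>P', (I - C) P'\<rangle> + \<langle>Q', C Q'\<rangle> = \<parallel>W\<parallel>\<^sup>2 + \<langle>Q, C Q\<rangle> - \<parallel>C Q\<parallel>\<^sup>2\<close>.
  Here \<open>\<parallel>W\<parallel>\<^sup>2 \<le> q\<^sup>2 \<langle>P, B D B P\<rangle>\<close> is bounded through the largest eigenvalue of the pencil
  \<open>(A B, I - C)\<close>, and \<open>\<parallel>C Q\<parallel>\<^sup>2 \<ge> \<lambda>\<^sub>2(C) \<langle>Q, C Q\<rangle>\<close>, so the left-hand side is a Lyapunov function that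
  contracts by \<open>\<delta>\<close>.
\<close>

section \<open>Extremal eigenvalues\<close>

lemma symmetric_inner:
  fixes M :: "real ^ 'n::finite ^ 'n"
  assumes "symmetric M"
  shows "(M *v x) \<bullet> y = x \<bullet> (M *v y)"
  by (metis assms dot_lmul_matrix symmetric_def transpose_matrix_vector)

text \<open>If \<open>b = u \<bullet> (N *v v)\<close> were nonzero, the form at
  \<open>v + t *\<^sub>R u\<close> would be \<open>2 * t * b + t\<^sup>2 * c\<close>, which is
  negative for small \<open>t\<close> of sign opposite to \<open>b\<close>. This stands in for
  differentiation at extremal points.\<close>

lemma form_radical:
  fixes N :: "real ^ 'n::finite ^ 'n"
  assumes N: "symmetric N" and T: "subspace T"
    and psd: "\<And>u. u \<in> T \<Longrightarrow> 0 \<le> u \<bullet> (N *v u)"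
    and v: "v \<in> T" "v \<bullet> (N *v v) = 0" and u: "u \<in> T"
  shows "u \<bullet> (N *v v) = 0"
proof (rule ccontr)
  define b c where "b = u \<bullet> (N *v v)" and "c = u \<bullet> (N *v u)"
  assume "u \<bullet> (N *v v) \<noteq> 0"
  then have b: "b\<^sup>2 > 0" by (simp add: b_def)
  have c: "c \<ge> 0" using psd[OF u] by (simp add: c_def)
  \<comment> \<open>The minimiser of the quadratic would be \<open>- b / c\<close>; the added 1
    keeps the denominator positive when \<open>c = 0\<close>.\<close>
  define t where "t = - b / (c + 1)"
  have "v + t *\<^sub>R u \<in> T" using T u v by (simp add: subspace_add subspace_scale)
  then have "0 \<le> (v + t *\<^sub>R u) \<bullet> (N *v (v + t *\<^sub>R u))" by (rule psd)
  also have "v \<bullet> (N *v u) = b"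
    using symmetric_inner[OF N, of u v] by (simp add: b_def symmetric_inner[OF N] inner_commute)
  then have "(v + t *\<^sub>R u) \<bullet> (N *v (v + t *\<^sub>R u)) = 2 * t * b + t\<^sup>2 * c"
    using v by (simp add: matrix_vector_right_distrib matrix_vector_mult_scaleR inner_add b_def c_def
        power2_eq_square algebra_simps)
  also have "\<dots> = - (b\<^sup>2 * (c + 2)) / (c + 1)\<^sup>2"
  proof -
    have "c + 1 \<noteq> 0" using c by simp
    then show ?thesis by (simp add: t_def divide_simps) (simp add: power2_eq_square algebra_simps)
  qed
  also have "\<dots> < 0" using b c by (simp add: divide_less_0_iff mult_pos_pos)
  finally show False by simp
qed

text \<open>The quotient of the two forms attains a maximum \<open>l\<close> on the compact unit
  sphere of \<open>T\<close>. There the form of \<open>l *\<^sub>R M - S\<close> vanishes, and it is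
  nonnegative on \<open>T\<close>, so \<open>form_radical\<close> yields the eigenvalue equation,
  tested against \<open>T\<close> only.\<close>

lemma rayleigh_maximizer:
  fixes S M :: "real ^ 'n::finite ^ 'n"
  assumes S: "symmetric S" and M: "symmetric M" and T: "subspace T" "T \<noteq> {0}"
    and pos: "\<And>v. v \<in> T \<Longrightarrow> v \<noteq> 0 \<Longrightarrow> 0 < v \<bullet> (M *v v)"
  obtains v l where "v \<in> T" "v \<noteq> 0"
    and "\<And>u. u \<in> T \<Longrightarrow> u \<bullet> (S *v v) = l * (u \<bullet> (M *v v))"
    and "\<And>u. u \<in> T \<Longrightarrow> u \<bullet> (S *v u) \<le> l * (u \<bullet> (M *v u))"
proof -
  define g where "g u = (u \<bullet> (S *v u)) / (u \<bullet> (M *v u))" for u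
  let ?K = "T \<inter> sphere 0 1"
  have "compact ?K"
    by (simp add: closed_Int_compact closed_subspace T)
  moreover obtain w where w: "w \<in> T" "w \<noteq> 0" using T subspace_0 by blast
  then have "(1 / norm w) *\<^sub>R w \<in> ?K" using T by (simp add: subspace_scale)
  then have "?K \<noteq> {}" by blast
  moreover have "u \<bullet> (M *v u) \<noteq> 0" if "u \<in> ?K" for u
    using pos[of u] that by (cases "u = 0") auto
  then have "continuous_on ?K g"
    unfolding g_def
    by (intro continuous_intros matrix_vector_mult_linear_continuous_on) auto
  ultimately obtain v where v: "v \<in> ?K" and max: "\<And>u. u \<in> ?K \<Longrightarrow> g u \<le> g v"
    using continuous_attains_sup[of ?K g] by blast
  define l where "l = g v"
  have vT: "v \<in> T" "v \<noteq> 0" using v by auto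
  have le: "u \<bullet> (S *v u) \<le> l * (u \<bullet> (M *v u))" if u: "u \<in> T" for u
  proof (cases "u = 0")
    case False
    define u' where "u' = (1 / norm u) *\<^sub>R u"
    have u': "u' \<in> ?K" using T u False by (simp add: u'_def subspace_scale)
    have "g u = g u'"
      using False by (simp add: g_def u'_def matrix_vector_mult_scaleR)
    then have "g u \<le> l" using max[OF u'] by (simp add: l_def)
    then show ?thesis using pos[OF u False] by (simp add: g_def divide_le_eq)
  qed simp
  define N where "N = l *\<^sub>R M - S"
  have N_mult: "N *v u = l *\<^sub>R (M *v u) - S *v u" for u
    by (simp add: N_def matrix_vector_mult_diff_rdistrib scaleR_matrix_vector_assoc)
  have N: "symmetric N"
    using S M by (simp add: symmetric_def N_def transpose_def vec_eq_iff)
  have "v \<bullet> (N *v v) = 0"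
    using pos[OF vT] by (simp add: N_mult inner_diff_right l_def g_def)
  then have "u \<bullet> (N *v v) = 0" if "u \<in> T" for u
    using form_radical[OF N T(1) _ vT(1) _ that] le by (simp add: N_mult inner_diff_right)
  then have "u \<bullet> (S *v v) = l * (u \<bullet> (M *v v))" if "u \<in> T" for u
    using that by (simp add: N_mult inner_diff_right)
  with le vT show thesis using that by blast
qed

lemma rayleigh_minimizer:
  fixes S :: "real ^ 'n::finite ^ 'n"
  assumes S: "symmetric S" and T: "subspace T" "T \<noteq> {0}"
  obtains v l where "v \<in> T" "v \<noteq> 0"
    and "\<And>u. u \<in> T \<Longrightarrow> u \<bullet> (S *v v) = l * (u \<bullet> v)"
    and "\<And>u. u \<in> T \<Longrightarrow> l * (u \<bullet> u) \<le> u \<bullet> (S *v u)"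
proof -
  have S': "symmetric (- S)" using S by (simp add: symmetric_def transpose_def vec_eq_iff)
  have I: "symmetric (mat 1 :: real ^ 'n ^ 'n)" by (simp add: symmetric_def transpose_mat)
  have neg: "(- S) *v x = - (S *v x)" for x
    using matrix_vector_mult_diff_rdistrib[of 0 S x] by simp
  have pos: "0 < v \<bullet> (mat 1 *v v)" if "v \<in> T" "v \<noteq> 0" for v :: "real ^ 'n"
    using that by simp
  obtain v l where "v \<in> T" "v \<noteq> 0"
    and "\<And>u. u \<in> T \<Longrightarrow> u \<bullet> ((- S) *v v) = l * (u \<bullet> (mat 1 *v v))"
    and "\<And>u. u \<in> T \<Longrightarrow> u \<bullet> ((- S) *v u) \<le> l * (u \<bullet> (mat 1 *v u))"
    using rayleigh_maximizer[OF S' I T pos] by blast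
  then show thesis
    by (intro that[of v "- l"]) (force simp: neg minus_le_iff minus_equation_iff)+
qed

lemma sum_eigenvectors_eq_0:
  fixes A :: "real ^ 'n::finite ^ 'n"
  assumes "finite F" and "\<And>l. l \<in> F \<Longrightarrow> A *v w l = l *\<^sub>R w l" and "(\<Sum>l\<in>F. w l) = 0"
  shows "\<forall>l\<in>F. w l = 0"
  using assms
proof (induction F arbitrary: w rule: finite_induct)
  case (insert k F)
  have "(\<Sum>l\<in>F. (l - k) *\<^sub>R w l) = (\<Sum>l\<in>insert k F. A *v w l - k *\<^sub>R w l)"
  proof -
    have "(\<Sum>l\<in>insert k F. A *v w l - k *\<^sub>R w l) = (\<Sum>l\<in>insert k F. (l - k) *\<^sub>R w l)"
      by (intro sum.cong refl) (simp add: insert.prems(1) scaleR_diff_left)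
    then show ?thesis using insert.hyps by simp
  qed
  also have "\<dots> = A *v (\<Sum>l\<in>insert k F. w l) - k *\<^sub>R (\<Sum>l\<in>insert k F. w l)"
    by (simp only: sum_subtractf scaleR_sum_right linear_sum[OF matrix_vector_mul_linear])
  also have "\<dots> = 0" using insert.prems(2) by simp
  finally have sum: "(\<Sum>l\<in>F. (l - k) *\<^sub>R w l) = 0" .
  have "A *v ((l - k) *\<^sub>R w l) = l *\<^sub>R ((l - k) *\<^sub>R w l)" if "l \<in> F" for l
    using insert.prems(1)[of l] that by (simp only: matrix_vector_mult_scaleR) simp
  then have "\<forall>l\<in>F. (l - k) *\<^sub>R w l = 0"
    using sum by (rule insert.IH)
  then have "\<forall>l\<in>F. w l = 0" using insert.hyps by auto
  then show ?case using insert.prems(2) insert.hyps by simp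
qed simp

text \<open>More than \<open>CARD('n)\<close> eigenvalues would give too many independent
  eigenvectors. Finiteness makes the \<open>Min\<close> and \<open>Max\<close> behind
  \<open>lambda_min\<close> and \<open>lambda_max\<close> meaningful.\<close>

lemma finite_eigenvalues:
  fixes A :: "real ^ 'n::finite ^ 'n"
  shows "finite (eigenvalues A)"
proof (rule ccontr)
  assume "infinite (eigenvalues A)"
  then obtain F where F: "finite F" "card F = Suc CARD('n)" "F \<subseteq> eigenvalues A"
    using infinite_arbitrarily_large by blast
  then have "\<forall>l\<in>F. \<exists>v. v \<noteq> 0 \<and> A *v v = l *\<^sub>R v" by (auto simp: eigenvalues_def)
  then obtain w where w: "\<And>l. l \<in> F \<Longrightarrow> w l \<noteq> 0" "\<And>l. l \<in> F \<Longrightarrow> A *v w l = l *\<^sub>R w l"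
    by metis
  have inj: "inj_on w F"
    by (rule inj_onI) (metis w scaleR_cancel_right)
  have "independent (w ` F)"
  proof (rule independent_if_scalars_zero)
    fix c x assume *: "(\<Sum>x\<in>w ` F. c x *\<^sub>R x) = 0" and "x \<in> w ` F"
    then obtain l where l: "l \<in> F" "x = w l" by blast
    have "(\<Sum>l\<in>F. c (w l) *\<^sub>R w l) = 0"
      using * by (simp add: sum.reindex[OF inj])
    moreover have "A *v (c (w l) *\<^sub>R w l) = l *\<^sub>R (c (w l) *\<^sub>R w l)" if "l \<in> F" for l
      using w(2)[OF that] by (simp only: matrix_vector_mult_scaleR) simp
    ultimately have "\<forall>l\<in>F. c (w l) *\<^sub>R w l = 0"
      using sum_eigenvectors_eq_0[OF F(1), of A "\<lambda>l. c (w l) *\<^sub>R w l"] by blast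
    then show "c x = 0" using l w by auto
  qed (use F in simp)
  then have "card (w ` F) \<le> CARD('n)" using independent_bound[of "w ` F"] by simp
  then show False using F card_image[OF inj] by simp
qed

lemma UNIV_vec_neq_0: "(UNIV :: (real ^ 'n::finite) set) \<noteq> {0}"
proof -
  have "axis undefined 1 \<noteq> (0 :: real ^ 'n)" by (simp add: axis_eq_0_iff)
  then show ?thesis by blast
qed

lemma positive_definite_matrix_inv:
  fixes M :: "real ^ 'n::finite ^ 'n"
  assumes pos: "\<And>v. v \<noteq> 0 \<Longrightarrow> 0 < v \<bullet> (M *v v)"
  shows "M ** matrix_inv M = mat 1" and "matrix_inv M ** M = mat 1"
proof -
  have "M *v x = 0 \<Longrightarrow> x = 0" for x using pos[of x] by auto
  then have "\<exists>N. N ** M = mat 1"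
    by (simp add: matrix_left_invertible_ker)
  then have "\<exists>N. M ** N = mat 1 \<and> N ** M = mat 1"
    using matrix_left_right_inverse by blast
  then have "M ** matrix_inv M = mat 1 \<and> matrix_inv M ** M = mat 1"
    unfolding matrix_inv_def by (rule someI_ex)
  then show "M ** matrix_inv M = mat 1" and "matrix_inv M ** M = mat 1" by auto
qed

text \<open>The largest quotient \<open>l\<close> satisfies \<open>S v = l M v\<close>, so
  \<open>M v\<close> is an eigenvector of \<open>S ** matrix_inv M\<close> for \<open>l\<close>.
  Thus a product that may fail to be symmetric still controls symmetric forms.\<close>

lemma le_lambda_max_pencil:
  fixes S M :: "real ^ 'n::finite ^ 'n"
  assumes S: "symmetric S" and M: "symmetric M"
    and pos: "\<And>v. v \<noteq> 0 \<Longrightarrow> 0 < v \<bullet> (M *v v)"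
  shows "u \<bullet> (S *v u) \<le> lambda_max (S ** matrix_inv M) * (u \<bullet> (M *v u))"
proof -
  obtain v l where v: "v \<noteq> 0"
    and ev: "\<And>u. u \<bullet> (S *v v) = l * (u \<bullet> (M *v v))"
    and le: "\<And>u. u \<bullet> (S *v u) \<le> l * (u \<bullet> (M *v u))"
    using rayleigh_maximizer[OF S M subspace_UNIV UNIV_vec_neq_0 pos] by (metis UNIV_I)
  have ev': "S *v v = l *\<^sub>R (M *v v)"
    using ev by (intro vector_eq_ldot[THEN iffD1]) simp
  note inv = positive_definite_matrix_inv(2)[OF pos]
  have "(S ** matrix_inv M) *v (M *v v) = S *v ((matrix_inv M ** M) *v v)"
    by (simp add: matrix_vector_mul_assoc matrix_mul_assoc)
  also have "\<dots> = l *\<^sub>R (M *v v)" by (simp add: inv ev')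
  finally have "l \<in> eigenvalues (S ** matrix_inv M)"
    using pos[OF v] by (auto simp: eigenvalues_def intro!: exI[of _ "M *v v"])
  then have "l \<le> lambda_max (S ** matrix_inv M)"
    by (simp add: lambda_max_def finite_eigenvalues)
  moreover have "0 \<le> u \<bullet> (M *v u)" using pos[of u] by (cases "u = 0") auto
  ultimately show ?thesis using le[of u] by (meson mult_right_mono order_trans)
qed

lemma lambda_min_symmetric:
  fixes S :: "real ^ 'n::finite ^ 'n"
  assumes S: "symmetric S"
  shows "lambda_min S \<in> eigenvalues S"
    and "lambda_min S * (u \<bullet> u) \<le> u \<bullet> (S *v u)"
proof -
  obtain v l where v: "v \<noteq> 0"
    and ev: "\<And>u. u \<bullet> (S *v v) = l * (u \<bullet> v)"
    and le: "\<And>u. l * (u \<bullet> u) \<le> u \<bullet> (S *v u)"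
    using rayleigh_minimizer[OF S subspace_UNIV UNIV_vec_neq_0] by (metis UNIV_I)
  have "S *v v = l *\<^sub>R v"
    using ev by (intro vector_eq_ldot[THEN iffD1]) simp
  then have l: "l \<in> eigenvalues S" using v by (auto simp: eigenvalues_def)
  then show "lambda_min S \<in> eigenvalues S"
    unfolding lambda_min_def using finite_eigenvalues Min_in by blast
  have "lambda_min S \<le> l" using l by (simp add: lambda_min_def finite_eigenvalues)
  then show "lambda_min S * (u \<bullet> u) \<le> u \<bullet> (S *v u)"
    using le[of u] by (meson inner_ge_zero mult_right_mono order_trans)
qed

text \<open>Zero is the least eigenvalue and has multiplicity one, so the sorted list starts with a
  single 0 and position 1 holds the least nonzero eigenvalue. The given \<open>\<mu>\<close>
  guarantees that this position exists.\<close>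

lemma lambda_2_in_nonzero_eigenvalues:
  fixes C :: "real ^ 'n::finite ^ 'n"
  assumes psd: "0 \<preceq> C" and null: "null_space C = span {w}" "w \<noteq> 0"
    and mu: "\<mu> \<in> eigenvalues C" "\<mu> \<noteq> 0"
  shows "lambda_2 C \<in> eigenvalues C - {0}" and "lambda_2 C \<le> \<mu>"
proof -
  let ?m = "\<lambda>l. replicate_mset (dim (eigenspace C l)) l"
  let ?R = "\<Sum>l\<in>eigenvalues C - {0}. ?m l"
  have nonneg: "0 \<le> l" if l: "l \<in> eigenvalues C" for l
  proof -
    obtain v where v: "v \<noteq> 0" "C *v v = l *\<^sub>R v" using l by (auto simp: eigenvalues_def)
    then have "0 \<le> l * (v \<bullet> v)" using psd unfolding loewner_le_def
      by (metis diff_zero inner_scaleR_right)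
    then show ?thesis using v by (metis inner_gt_zero_iff linorder_not_le mult_neg_pos)
  qed
  have "w \<in> null_space C" using null by (simp add: span_base)
  then have "C *v w = 0" by (simp add: null_space_def)
  then have zero: "0 \<in> eigenvalues C" using null(2) by (auto simp: eigenvalues_def)
  have "eigenspace C 0 = span {w}" using null by (auto simp: eigenspace_def null_space_def)
  then have dim0: "dim (eigenspace C 0) = 1" using null(2) by (simp add: dim_span dim_insert)
  have pos_dim: "dim (eigenspace C l) > 0" if l: "l \<in> eigenvalues C" for l
  proof -
    obtain v where v: "v \<noteq> 0" "C *v v = l *\<^sub>R v" using l by (auto simp: eigenvalues_def)
    then have "v \<in> eigenspace C l" "v \<notin> {0}" by (auto simp: eigenspace_def)
    then show ?thesis by (metis dim_eq_0 gr0I subsetD)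
  qed
  have setR: "set_mset ?R = eigenvalues C - {0}"
  proof -
    have "set_mset ?R = (\<Union>l\<in>eigenvalues C - {0}. set_mset (?m l))"
      using finite_eigenvalues[of C] by (simp add: set_mset_sum)
    also have "\<dots> = (\<Union>l\<in>eigenvalues C - {0}. {l})"
      using pos_dim by (intro SUP_cong refl) (metis DiffD1 less_numeral_extra(3) set_mset_replicate_mset_subset)
    finally show ?thesis by simp
  qed
  have "(\<Sum>l\<in>eigenvalues C. ?m l) = add_mset 0 ?R"
    using sum.remove[OF finite_eigenvalues zero, of ?m] dim0 by simp
  then have "eigenvalue_list C = insort 0 (sorted_list_of_multiset ?R)"
    by (simp add: eigenvalue_list_def)
  also have "\<dots> = 0 # sorted_list_of_multiset ?R"
    using nonneg by (intro insort_is_Cons) (simp add: setR)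
  finally have eq: "lambda_2 C = sorted_list_of_multiset ?R ! 0" by (simp add: lambda_2_def)
  obtain x xs where xs: "sorted_list_of_multiset ?R = x # xs"
    using mu setR by (metis DiffI empty_iff empty_set list.exhaust set_sorted_list_of_multiset singletonD)
  have "sorted (x # xs)" using sorted_sorted_list_of_multiset[of ?R] xs by simp
  moreover have set: "set (x # xs) = eigenvalues C - {0}"
    using set_sorted_list_of_multiset[of ?R] xs setR by simp
  moreover have "\<mu> \<in> set (x # xs)" using mu set by blast
  ultimately have "x \<le> \<mu>" by auto
  then show "lambda_2 C \<le> \<mu>" using eq xs by simp
  show "lambda_2 C \<in> eigenvalues C - {0}" using eq xs set by auto
qed

text \<open>On the complement of \<open>w\<close> the least Rayleigh quotient is a nonzero
  eigenvalue, hence at least \<open>lambda_2 C\<close>. For the projection \<open>x\<close> of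
  \<open>u\<close> this bounds \<open>lambda_2 C * (x \<bullet> x)\<close> by the form at
  \<open>u\<close>; Cauchy-Schwarz for \<open>x\<close> and \<open>C *v u\<close> then gives the
  claim without diagonalising \<open>C\<close>.\<close>

lemma lambda_2_form_le:
  fixes C :: "real ^ 'n::finite ^ 'n"
  assumes n: "CARD('n) \<ge> 2" and psd: "0 \<preceq> C" and null: "null_space C = span {w}" "w \<noteq> 0"
  shows "lambda_2 C \<in> eigenvalues C" and "0 < lambda_2 C"
    and "lambda_2 C * (u \<bullet> (C *v u)) \<le> (C *v u) \<bullet> (C *v u)"
proof -
  have C: "symmetric C" using psd by (simp add: loewner_le_def)
  have form: "0 \<le> v \<bullet> (C *v v)" for v using psd by (simp add: loewner_le_def)
  have "w \<in> null_space C" using null by (simp add: span_base)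
  then have Cw: "C *v w = 0" by (simp add: null_space_def)
  define T where "T = {x. w \<bullet> x = 0}"
  have T: "subspace T" by (simp add: T_def subspace_hyperplane)
  have "dim T = CARD('n) - 1" using dim_hyperplane[OF null(2)] by (simp add: T_def)
  then have "T \<noteq> {0}" using n by auto
  then obtain v k where v: "v \<in> T" "v \<noteq> 0"
    and ev: "\<And>u. u \<in> T \<Longrightarrow> u \<bullet> (C *v v) = k * (u \<bullet> v)"
    and le: "\<And>u. u \<in> T \<Longrightarrow> k * (u \<bullet> u) \<le> u \<bullet> (C *v u)"
    using rayleigh_minimizer[OF C T] by blast
  have "C *v x \<in> T" for x
    using symmetric_inner[OF C, of w x] by (simp add: T_def Cw)
  \<comment> \<open>The residual lies in \<open>T\<close> and is orthogonal to \<open>T\<close>, so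
    it is zero.\<close>
  then have "C *v v - k *\<^sub>R v \<in> T" using T v by (simp add: subspace_diff subspace_scale)
  then have "(C *v v - k *\<^sub>R v) \<bullet> (C *v v - k *\<^sub>R v) = 0"
    using ev by (simp add: inner_diff_right)
  then have eig: "C *v v = k *\<^sub>R v" by simp
  have "k \<noteq> 0"
  proof
    assume "k = 0"
    then have "v \<in> span {w}" using eig null by (auto simp: null_space_def)
    then obtain c where "v = c *\<^sub>R w" by (auto simp: span_singleton)
    then show False using v by (auto simp: T_def)
  qed
  moreover have k: "k \<in> eigenvalues C" using eig v by (auto simp: eigenvalues_def)
  ultimately have l2: "lambda_2 C \<in> eigenvalues C - {0}" and l2k: "lambda_2 C \<le> k"
    using lambda_2_in_nonzero_eigenvalues[OF psd null] by auto
  then show "lambda_2 C \<in> eigenvalues C" by simp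
  obtain z where z: "z \<noteq> 0" "C *v z = lambda_2 C *\<^sub>R z" using l2 by (auto simp: eigenvalues_def)
  have "0 \<le> lambda_2 C * (z \<bullet> z)" using form[of z] z by simp
  then have "0 \<le> lambda_2 C" using z by (metis inner_gt_zero_iff linorder_not_le mult_neg_pos)
  then show pos: "0 < lambda_2 C" using l2 by auto
  define x where "x = u - ((w \<bullet> u) / (w \<bullet> w)) *\<^sub>R w"
  have xT: "x \<in> T" using null(2) by (simp add: x_def T_def inner_diff_right)
  have Cx: "C *v x = C *v u"
    by (simp add: x_def matrix_vector_mult_diff_distrib matrix_vector_mult_scaleR Cw)
  have "w \<bullet> (C *v u) = 0" using symmetric_inner[OF C, of w u] by (simp add: Cw)
  then have xu: "x \<bullet> (C *v u) = u \<bullet> (C *v u)" by (simp add: x_def inner_diff_left)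
  have b: "lambda_2 C * (x \<bullet> x) \<le> u \<bullet> (C *v u)"
    using le[OF xT] l2k xu Cx mult_right_mono[OF l2k, of "x \<bullet> x"] by simp
  have cs: "(u \<bullet> (C *v u))\<^sup>2 \<le> (x \<bullet> x) * ((C *v u) \<bullet> (C *v u))"
    using Cauchy_Schwarz_ineq[of x "C *v u"] by (simp add: xu)
  show "lambda_2 C * (u \<bullet> (C *v u)) \<le> (C *v u) \<bullet> (C *v u)"
  proof (cases "u \<bullet> (C *v u) = 0")
    case False
    then have p: "0 < u \<bullet> (C *v u)" using form[of u] by simp
    have "lambda_2 C * (u \<bullet> (C *v u))\<^sup>2 \<le> (lambda_2 C * (x \<bullet> x)) * ((C *v u) \<bullet> (C *v u))"
      using mult_left_mono[OF cs, of "lambda_2 C"] pos by (simp add: mult.assoc)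
    also have "\<dots> \<le> (u \<bullet> (C *v u)) * ((C *v u) \<bullet> (C *v u))"
      using b by (intro mult_right_mono) auto
    finally show ?thesis using p by (simp add: power2_eq_square algebra_simps)
  qed simp
qed

section \<open>Smooth strongly convex functions\<close>

text \<open>The Riesz vector of the derivative, here \<open>adjoint f' 1\<close>, is the only
  candidate, so the definite description in \<open>gradient\<close> denotes it.\<close>

lemma smooth_with_GDERIV:
  assumes "smooth_with L f"
  shows "GDERIV f x :> gradient f x"
proof -
  obtain f' where f': "(f has_derivative f') (at x)"
    using assms by (auto simp: smooth_with_def differentiable_def)
  have "f' = (\<lambda>h. h \<bullet> adjoint f' 1)"
    using adjoint_works[OF has_derivative_linear[OF f']] by simp
  then have g: "GDERIV f x :> adjoint f' 1" using f' by (simp add: gderiv_def)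
  moreover have "h = adjoint f' 1" if "GDERIV f x :> h" for h
    using has_derivative_unique[OF that[unfolded gderiv_def] g[unfolded gderiv_def]]
    by (metis vector_eq_ldot)
  ultimately show ?thesis unfolding gradient_def by (rule theI)
qed

lemma GDERIV_line:
  fixes f :: "'a::real_inner \<Rightarrow> real"
  assumes "GDERIV f (x + t *\<^sub>R v) :> g"
  shows "((\<lambda>t. f (x + t *\<^sub>R v)) has_real_derivative (v \<bullet> g)) (at t)"
proof -
  have "((\<lambda>t. x + t *\<^sub>R v) has_derivative (\<lambda>s. s *\<^sub>R v)) (at t)"
    by (auto intro!: derivative_eq_intros)
  then have "((\<lambda>t. f (x + t *\<^sub>R v)) has_derivative (\<lambda>s. (s *\<^sub>R v) \<bullet> g)) (at t)"
    using assms unfolding gderiv_def by (rule has_derivative_compose)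
  then show ?thesis
    by (simp add: has_field_derivative_def mult.commute[of _ "v \<bullet> g"])
qed

text \<open>Strong convexity on the segment from \<open>x\<close> to \<open>y\<close>, divided by
  \<open>t\<close>, becomes this bound as \<open>t\<close> tends to 0 from the right.\<close>

lemma strongly_convex_first_order:
  fixes f :: "'a::real_inner \<Rightarrow> real"
  assumes sc: "strongly_convex \<mu> f" and g: "GDERIV f x :> g"
  shows "f x + g \<bullet> (y - x) + \<mu> / 2 * ((y - x) \<bullet> (y - x)) \<le> f y"
proof -
  define \<phi> where "\<phi> t = f (x + t *\<^sub>R (y - x))" for t
  have "(\<phi> has_real_derivative ((y - x) \<bullet> g)) (at 0)"
    unfolding \<phi>_def using g by (intro GDERIV_line) simp
  then have "((\<lambda>t. (\<phi> t - \<phi> 0) / t) \<longlongrightarrow> (y - x) \<bullet> g) (at 0)"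
    by (simp add: has_field_derivative_iff)
  then have lim: "((\<lambda>t. (\<phi> t - \<phi> 0) / t) \<longlongrightarrow> (y - x) \<bullet> g) (at_right 0)"
    by (rule tendsto_within_subset) simp
  have "((\<lambda>t. f y - f x - \<mu> / 2 * (1 - t) * ((y - x) \<bullet> (y - x))) \<longlongrightarrow>
      f y - f x - \<mu> / 2 * (1 - 0) * ((y - x) \<bullet> (y - x))) (at_right 0)"
    by (intro tendsto_intros)
  moreover have "\<forall>\<^sub>F t in at_right 0.
      (\<phi> t - \<phi> 0) / t \<le> f y - f x - \<mu> / 2 * (1 - t) * ((y - x) \<bullet> (y - x))"
    using eventually_at_right_less[of 0]
      eventually_at_right_real[of 0 1, simplified]
  proof eventually_elim
    case (elim t)
    then have t: "0 < t" "t \<le> 1" by auto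
    have "\<phi> t = f ((1 - t) *\<^sub>R x + t *\<^sub>R y)"
      by (simp add: \<phi>_def algebra_simps)
    also have "\<dots> \<le> (1 - t) * f x + t * f y - \<mu> / 2 * t * (1 - t) * (norm (x - y))\<^sup>2"
      using sc t by (simp add: strongly_convex_def)
    also have "(norm (x - y))\<^sup>2 = (y - x) \<bullet> (y - x)"
      by (metis norm_minus_commute power2_norm_eq_inner)
    finally have "\<phi> t - \<phi> 0 \<le> t * (f y - f x - \<mu> / 2 * (1 - t) * ((y - x) \<bullet> (y - x)))"
      by (simp add: \<phi>_def algebra_simps)
    then show ?case using t by (simp add: pos_divide_le_eq mult.commute)
  qed
  ultimately have "(y - x) \<bullet> g \<le> f y - f x - \<mu> / 2 * (1 - 0) * ((y - x) \<bullet> (y - x))"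
    using lim by (intro tendsto_le[of "at_right 0"]) auto
  then show ?thesis by (simp add: inner_commute)
qed

text \<open>The descent lemma. Subtracting the quadratic model along the segment leaves
  \<open>\<phi>\<close>, whose derivative is nonpositive by Cauchy-Schwarz and the Lipschitz bound;
  monotonicity takes the place of an integral.\<close>

lemma smooth_with_upper_bound:
  assumes f: "smooth_with L f"
  shows "f y \<le> f x + gradient f x \<bullet> (y - x) + L / 2 * ((y - x) \<bullet> (y - x))"
proof -
  define v where "v = y - x"
  define \<phi> where "\<phi> t = f (x + t *\<^sub>R v) - t * (v \<bullet> gradient f x) - L / 2 * t\<^sup>2 * (v \<bullet> v)" for t
  have d: "(\<phi> has_real_derivative
      (v \<bullet> gradient f (x + t *\<^sub>R v) - v \<bullet> gradient f x - L * t * (v \<bullet> v))) (at t)" for t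
    unfolding \<phi>_def
    by (rule derivative_eq_intros GDERIV_line smooth_with_GDERIV f refl | simp)+
  have neg: "v \<bullet> gradient f (x + t *\<^sub>R v) - v \<bullet> gradient f x - L * t * (v \<bullet> v) \<le> 0" if "0 \<le> t" for t
  proof -
    have "norm (gradient f (x + t *\<^sub>R v) - gradient f x) \<le> L * norm (t *\<^sub>R v)"
      using f lipschitz_onD[of L UNIV "gradient f" "x + t *\<^sub>R v" x]
      by (simp add: smooth_with_def dist_norm)
    then have "norm v * norm (gradient f (x + t *\<^sub>R v) - gradient f x) \<le> norm v * (L * (t * norm v))"
      using that by (intro mult_left_mono) auto
    moreover have "v \<bullet> (gradient f (x + t *\<^sub>R v) - gradient f x)
        \<le> norm v * norm (gradient f (x + t *\<^sub>R v) - gradient f x)"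
      by (rule norm_cauchy_schwarz)
    ultimately show ?thesis
      by (simp add: inner_diff_right dot_square_norm power2_eq_square algebra_simps)
  qed
  have "\<phi> 1 \<le> \<phi> 0"
    using d neg by (intro DERIV_nonpos_imp_nonincreasing[of 0 1]) (simp, blast)
  then show ?thesis by (simp add: \<phi>_def v_def inner_commute)
qed

text \<open>\<open>E\<close> is the inverse of \<open>D\<close>. As in the unweighted case, the lower model at \<open>b\<close> and the upper
  model at \<open>a\<close> are compared at the minimiser of a quadratic in \<open>t\<close>, here along \<open>a - t E e\<close> with
  \<open>e\<close> the gradient difference of \<open>F - \<mu>/2 \<langle>x, D x\<rangle>\<close>; keeping \<open>t\<close> free covers \<open>L = \<mu>\<close>.\<close>

lemma cocoercive_weighted:
  fixes F :: "'a::real_inner \<Rightarrow> real" and G D E :: "'a \<Rightarrow> 'a"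
  assumes D: "linear D" "\<And>x y. D x \<bullet> y = x \<bullet> D y" and E: "\<And>x. D (E x) = x"
    and lower: "\<And>x y. F x + G x \<bullet> (y - x) + \<mu> / 2 * ((y - x) \<bullet> D (y - x)) \<le> F y"
    and upper: "\<And>x y. F y \<le> F x + G x \<bullet> (y - x) + L / 2 * ((y - x) \<bullet> D (y - x))"
    and "\<mu> \<le> L"
  shows "(G x - G y) \<bullet> E (G x - G y) + L * \<mu> * ((x - y) \<bullet> D (x - y))
      \<le> (L + \<mu>) * ((x - y) \<bullet> (G x - G y))"
proof -
  define d \<Delta> e where "d = x - y" and "\<Delta> = G x - G y" and "e = \<Delta> - \<mu> *\<^sub>R D d"
  \<comment> \<open>\<open>E\<close> is given only as a right inverse map; the symmetry it inherits
    from \<open>D\<close> does the work of linearity below.\<close>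
  have Esym: "E u \<bullet> v = u \<bullet> E v" for u v by (metis D(2) E)
  have DE: "D u \<bullet> E v = u \<bullet> v" for u v by (simp add: D(2) E)
  have ED: "E u \<bullet> D v = u \<bullet> v" for u v by (metis D(2) E)
  define s where "s = e \<bullet> E e"
  \<comment> \<open>Kept general because it serves twice, for \<open>(x, y)\<close> with
    \<open>e\<close> and for \<open>(y, x)\<close> with \<open>- e\<close>; adding the two instances
    eliminates the values of \<open>F\<close>.\<close>
  have one: "t * s - (L - \<mu>) / 2 * t\<^sup>2 * s \<le> F a - F b - G b \<bullet> (a - b) - \<mu> / 2 * ((a - b) \<bullet> D (a - b))"
    if e': "e' \<bullet> E e' = s" "G a - G b = e' + \<mu> *\<^sub>R D (a - b)" for t a b e'
  proof -
    define z where "z = a - t *\<^sub>R E e'"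
    have 1: "z - b = (a - b) - t *\<^sub>R E e'" and 2: "z - a = - t *\<^sub>R E e'" by (auto simp: z_def)
    have "(w - t *\<^sub>R E e') \<bullet> D (w - t *\<^sub>R E e') = w \<bullet> D w - 2 * t * (e' \<bullet> w) + t\<^sup>2 * s" for w
      using e'(1)
      by (simp add: linear_diff[OF D(1)] linear_scale[OF D(1)] E ED DE inner_diff
          power2_eq_square algebra_simps inner_commute)
    then have q1: "(z - b) \<bullet> D (z - b) = (a - b) \<bullet> D (a - b) - 2 * t * (e' \<bullet> (a - b)) + t\<^sup>2 * s"
      unfolding 1 .
    have q2: "(z - a) \<bullet> D (z - a) = t\<^sup>2 * s"
      unfolding 2 using e'(1)
      by (simp add: linear_neg[OF D(1)] linear_scale[OF D(1)] E power2_eq_square inner_commute)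
    have g: "G a \<bullet> E e' - G b \<bullet> E e' = s + \<mu> * (e' \<bullet> (a - b))"
    proof -
      have "G a \<bullet> E e' - G b \<bullet> E e' = E e' \<bullet> (G a - G b)"
        by (simp add: inner_diff_right inner_commute)
      also have "\<dots> = E e' \<bullet> e' + \<mu> * (e' \<bullet> (a - b))"
        unfolding e'(2) by (simp only: inner_add_right inner_scaleR_right ED)
      finally show ?thesis using e'(1) by (simp add: inner_commute)
    qed
    have "F b + G b \<bullet> (z - b) + \<mu> / 2 * ((z - b) \<bullet> D (z - b))
        \<le> F a + G a \<bullet> (z - a) + L / 2 * ((z - a) \<bullet> D (z - a))"
      using lower[of b z] upper[of z a] by simp
    then have "F b + G b \<bullet> (a - b) - t * (G b \<bullet> E e')
        + \<mu> / 2 * ((a - b) \<bullet> D (a - b) - 2 * t * (e' \<bullet> (a - b)) + t\<^sup>2 * s)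
        \<le> F a - t * (G a \<bullet> E e') + L / 2 * (t\<^sup>2 * s)"
      unfolding q1 q2 unfolding 1 2 by (simp add: inner_diff_right)
    moreover have "t * (G a \<bullet> E e') = t * (G b \<bullet> E e') + t * s + \<mu> * t * (e' \<bullet> (a - b))"
      using arg_cong[OF g, of "\<lambda>u. t * u"] by (simp add: algebra_simps)
    ultimately show ?thesis by (simp add: field_simps)
  qed
  define r where "r = \<Delta> \<bullet> d - \<mu> * (d \<bullet> D d)"
  have lin: "D (y - x) = - D (x - y)" using linear_neg[OF D(1), of "x - y"] by simp
  have Eneg: "E (- e) = - E e"
  proof -
    have "E (- e) \<bullet> u = (- E e) \<bullet> u" for u
      by (simp add: Esym)
    then show ?thesis by (metis vector_eq_rdot)
  qed
  have key: "2 * t * s - (L - \<mu>) * t\<^sup>2 * s \<le> r" for t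
  proof -
    have "t * s - (L - \<mu>) / 2 * t\<^sup>2 * s \<le> F x - F y - G y \<bullet> (x - y) - \<mu> / 2 * ((x - y) \<bullet> D (x - y))"
      by (rule one[of e]) (simp_all add: s_def e_def \<Delta>_def d_def)
    moreover have "t * s - (L - \<mu>) / 2 * t\<^sup>2 * s \<le> F y - F x - G x \<bullet> (y - x) - \<mu> / 2 * ((y - x) \<bullet> D (y - x))"
    proof (rule one)
      show "(- e) \<bullet> E (- e) = s" by (simp add: s_def Eneg)
      show "G y - G x = - e + \<mu> *\<^sub>R D (y - x)" by (simp add: e_def \<Delta>_def d_def lin)
    qed
    moreover have "(y - x) \<bullet> D (y - x) = (x - y) \<bullet> D (x - y)"
      by (simp add: lin inner_diff_left)
    moreover have "r = - G y \<bullet> (x - y) - G x \<bullet> (y - x) - \<mu> * ((x - y) \<bullet> D (x - y))"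
      by (simp add: r_def \<Delta>_def d_def inner_diff_left inner_diff_right)
    moreover have "2 * t * s - (L - \<mu>) * t\<^sup>2 * s = 2 * (t * s - (L - \<mu>) / 2 * t\<^sup>2 * s)"
      by (simp add: field_simps)
    ultimately show ?thesis by simp
  qed
  have "s \<le> (L - \<mu>) * r"
  proof (cases "L = \<mu>")
    case True
    have "s = 0"
    proof (rule ccontr)
      assume "s \<noteq> 0"
      \<comment> \<open>For \<open>L = \<mu>\<close> the bound \<open>key\<close> is linear in
        \<open>t\<close>, and this \<open>t\<close> turns it into
        \<open>r + 1 \<le> r\<close>.\<close>
      then show False using key[of "(r + 1) / (2 * s)"] True by simp
    qed
    then show ?thesis using True by simp
  next
    case False
    \<comment> \<open>\<open>1 / (L - \<mu>)\<close> is the critical point of the quadratic in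
      \<open>t\<close> on the left of \<open>key\<close>.\<close>
    then have "s / (L - \<mu>) \<le> r" using key[of "1 / (L - \<mu>)"] by (simp add: power2_eq_square)
    then show ?thesis using False \<open>\<mu> \<le> L\<close> by (simp add: pos_divide_le_eq mult.commute)
  qed
  moreover have "s = \<Delta> \<bullet> E \<Delta> - 2 * \<mu> * (\<Delta> \<bullet> d) + \<mu>\<^sup>2 * (d \<bullet> D d)"
  proof -
    have "s = \<Delta> \<bullet> E e - \<mu> * (d \<bullet> e)" by (simp add: s_def e_def inner_diff_left DE)
    also have "\<Delta> \<bullet> E e = E \<Delta> \<bullet> \<Delta> - \<mu> * (\<Delta> \<bullet> d)"
      by (simp add: Esym[symmetric]) (simp add: e_def inner_diff_right ED)
    finally show ?thesis
      by (simp add: e_def inner_diff_right inner_commute power2_eq_square algebra_simps)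
  qed
  ultimately have "\<Delta> \<bullet> E \<Delta> + L * \<mu> * (d \<bullet> D d) \<le> (L + \<mu>) * (d \<bullet> \<Delta>)"
    by (simp add: r_def inner_commute power2_eq_square algebra_simps)
  then show ?thesis by (simp add: d_def \<Delta>_def)
qed

section \<open>Linear maps on stacked vectors\<close>

text \<open>Left multiplication acts on each column separately, so through this identity
  inequalities between forms on vectors carry over to stacked matrices.\<close>

lemma inner_eq_sum_columns:
  fixes X Y :: "real ^ 'd::finite ^ 'm::finite"
  shows "X \<bullet> Y = (\<Sum>j\<in>UNIV. column j X \<bullet> column j Y)"
  by (simp add: inner_vec_def column_def) (rule sum.swap)

lemma column_matrix_mult: "column j (A ** X) = A *v column j X"
  by (simp add: column_def matrix_matrix_mult_def matrix_vector_mult_def vec_eq_iff)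

lemma linear_matrix_mult_left:
  fixes A :: "real ^ 'm::finite ^ 'n::finite"
  shows "linear (\<lambda>X :: real ^ 'd::finite ^ 'm. A ** X)"
  by (rule linearI)
    (simp_all add: matrix_matrix_mult_def vec_eq_iff sum.distrib sum_distrib_left algebra_simps)

lemmas matrix_mult_left_linear_simps =
  linear_add[OF linear_matrix_mult_left] linear_diff[OF linear_matrix_mult_left]
  linear_scale[OF linear_matrix_mult_left]

lemma matrix_mult_outer: "A ** outer u v = outer (A *v u) v"
  by (simp add: outer_def matrix_matrix_mult_def matrix_vector_mult_def vec_eq_iff
      sum_distrib_right mult.assoc)

lemma symmetric_inner_matrix:
  fixes M :: "real ^ 'm::finite ^ 'm" and X Y :: "real ^ 'd::finite ^ 'm"
  assumes "symmetric M"
  shows "(M ** X) \<bullet> Y = X \<bullet> (M ** Y)"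
  by (simp add: inner_eq_sum_columns column_matrix_mult symmetric_inner[OF assms])

lemma form_mono_matrix:
  fixes M N :: "real ^ 'm::finite ^ 'm" and X :: "real ^ 'd::finite ^ 'm"
  assumes "\<And>v. v \<bullet> (M *v v) \<le> c * (v \<bullet> (N *v v))"
  shows "X \<bullet> (M ** X) \<le> c * (X \<bullet> (N ** X))"
  by (simp add: inner_eq_sum_columns column_matrix_mult sum_distrib_left sum_mono assms)

lemma form_nonneg_matrix:
  fixes M :: "real ^ 'm::finite ^ 'm" and X :: "real ^ 'd::finite ^ 'm"
  assumes "\<And>v. 0 \<le> v \<bullet> (M *v v)"
  shows "0 \<le> X \<bullet> (M ** X)"
  by (simp add: inner_eq_sum_columns column_matrix_mult sum_nonneg assms)

text \<open>The component \<open>z\<close> of \<open>x\<close> orthogonal to the range is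
  annihilated by \<open>C\<close>, hence a multiple of \<open>w\<close>. So it is orthogonal to
  \<open>x\<close> and to the range component \<open>y\<close>, and therefore to itself.\<close>

lemma in_range_symmetric:
  fixes C :: "real ^ 'n::finite ^ 'n"
  assumes C: "symmetric C" and null: "null_space C = span {w}" and x: "w \<bullet> x = 0"
  obtains q where "C *v q = x"
proof -
  let ?S = "range ((*v) C)"
  have S: "span ?S = ?S"
    by (simp add: linear_subspace_image span_eq_iff[THEN iffD2])
  obtain y z where y: "y \<in> span ?S" and z: "\<And>u. u \<in> span ?S \<Longrightarrow> orthogonal z u" and xyz: "x = y + z"
    using orthogonal_subspace_decomp_exists[of ?S x] by metis
  have "(C *v z) \<bullet> u = 0" for u
    using z[of "C *v u"] by (simp add: S symmetric_inner[OF C] orthogonal_def)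
  then have "C *v z = 0" by (metis inner_eq_zero_iff)
  then have "z \<in> span {w}" using null by (auto simp: null_space_def)
  then obtain c where c: "z = c *\<^sub>R w" by (auto simp: span_singleton)
  have "z \<bullet> z = z \<bullet> x - z \<bullet> y" by (simp add: xyz inner_add_right)
  also have "\<dots> = 0" using z[OF y] x by (simp add: c orthogonal_def)
  finally have "x = y" by (simp add: xyz)
  then show thesis using y that by (auto simp: S)
qed

section \<open>Contraction of the gradient step\<close>

text \<open>The lower and upper quadratic models at 0 are compared at a unit vector.\<close>

lemma strong_convexity_le_smoothness:
  fixes f :: "real ^ 'd::finite \<Rightarrow> real"
  assumes "strongly_convex \<mu> f" and "smooth_with L f"
  shows "\<mu> \<le> L"
proof -
  define v :: "real ^ 'd" where "v = axis undefined 1"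
  have "v \<bullet> v = 1" by (simp add: v_def inner_axis_axis)
  then show ?thesis
    using strongly_convex_first_order[OF assms(1) smooth_with_GDERIV[OF assms(2)], of 0 v]
      smooth_with_upper_bound[OF assms(2), of v 0] by simp
qed

text \<open>This is \<open>D\<^sup>2 \<preceq> D\<close> columnwise. Expanding the form of
  \<open>D\<close> at \<open>U - D ** U\<close> avoids a square root of \<open>D\<close>.\<close>

lemma contraction_in_square_form:
  fixes D :: "real ^ 'm::finite ^ 'm" and U :: "real ^ 'd::finite ^ 'm"
  assumes D: "0 \<prec> D" "D \<preceq> mat 1"
  shows "(D ** U) \<bullet> (D ** U) \<le> U \<bullet> (D ** U)"
proof -
  have sym: "symmetric D" using D by (simp add: loewner_le_def)
  have pos: "0 \<le> v \<bullet> (D *v v)" for v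
    using D(1) by (cases "v = 0") (auto simp: loewner_less_def less_imp_le)
  have le: "v \<bullet> (D *v v) \<le> 1 * (v \<bullet> (mat 1 *v v))" for v
    using D(2) by (simp add: loewner_le_def matrix_vector_mult_diff_rdistrib inner_diff_right)
  have "0 \<le> (U - D ** U) \<bullet> (D ** (U - D ** U))"
    using form_nonneg_matrix[OF pos] .
  also have "\<dots> = U \<bullet> (D ** U) - 2 * ((D ** U) \<bullet> (D ** U)) + (D ** U) \<bullet> (D ** (D ** U))"
    by (simp add: matrix_mult_left_linear_simps inner_diff symmetric_inner_matrix[OF sym])
  also have "(D ** U) \<bullet> (D ** (D ** U)) \<le> (D ** U) \<bullet> (D ** U)"
    using form_mono_matrix[OF le, of "D ** U"] by simp
  finally show ?thesis by simp
qed

lemma lambda_min_bounds: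
  fixes D :: "real ^ 'm::finite ^ 'm"
  assumes D: "0 \<prec> D" "D \<preceq> mat 1"
  shows "0 < lambda_min D" and "lambda_min D \<le> 1"
proof -
  have "symmetric D" using D by (simp add: loewner_le_def)
  then obtain v where v: "v \<noteq> 0" "D *v v = lambda_min D *\<^sub>R v"
    using lambda_min_symmetric(1) by (fastforce simp: eigenvalues_def)
  then have vv: "0 < v \<bullet> v" by simp
  have "0 < v \<bullet> (D *v v)" using D(1) v(1) by (simp add: loewner_less_def)
  then show "0 < lambda_min D" using vv by (simp add: v(2) zero_less_mult_iff)
  have "v \<bullet> (D *v v) \<le> v \<bullet> v"
    using D(2) by (simp add: loewner_le_def matrix_vector_mult_diff_rdistrib inner_diff_right)
  then show "lambda_min D \<le> 1" using vv by (simp add: v(2))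
qed

text \<open>Squaring undoes the root because the radicand is nonnegative: the step-size bound
  reduces this to \<open>4 * L * \<mu> * l \<le> (L + \<mu> * l)\<^sup>2\<close>, that is, to
  \<open>(L - \<mu> * l)\<^sup>2 \<ge> 0\<close>.\<close>

lemma q_factor_sq:
  fixes D :: "real ^ 'm::finite ^ 'm"
  assumes D: "0 \<prec> D" "D \<preceq> mat 1" and mu: "0 < \<mu>" "\<mu> \<le> L"
    and gamma: "0 < \<gamma>" "\<gamma> \<le> gamma_star L \<mu> D"
  shows "\<gamma> * (L + \<mu> * lambda_min D) \<le> 2 * lambda_min D"
    and "(q_factor L \<mu> D \<gamma>)\<^sup>2 = 1 - 2 * \<gamma> * L * \<mu> / (L + \<mu> * lambda_min D)"
proof -
  define l where "l = lambda_min D"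
  define K where "K = L + \<mu> * l"
  have l: "0 < l" using lambda_min_bounds(1)[OF D] by (simp add: l_def)
  then have K: "0 < K" using mu by (simp add: K_def add_pos_pos)
  have gK: "\<gamma> * K \<le> 2 * l"
    using gamma(2) K by (simp add: gamma_star_def K_def[symmetric] l_def[symmetric] pos_le_divide_eq)
  then show "\<gamma> * (L + \<mu> * lambda_min D) \<le> 2 * lambda_min D" by (simp add: K_def l_def)
  have eq: "2 * \<gamma> * L / (L / \<mu> + l) = 2 * \<gamma> * L * \<mu> / K"
    using mu l by (simp add: K_def divide_simps) (simp add: algebra_simps)
  have "2 * \<gamma> * L * \<mu> * K = (\<gamma> * K) * (2 * L * \<mu>)" by simp
  also have "\<dots> \<le> (2 * l) * (2 * L * \<mu>)" using gK mu by (intro mult_right_mono) auto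
  also have "\<dots> \<le> K * K"
    using zero_le_square[of "L - \<mu> * l"] by (simp add: K_def algebra_simps)
  finally have "2 * \<gamma> * L * \<mu> \<le> K" using K by simp
  then have "2 * \<gamma> * L * \<mu> / K \<le> 1" using K by simp
  then show "(q_factor L \<mu> D \<gamma>)\<^sup>2 = 1 - 2 * \<gamma> * L * \<mu> / (L + \<mu> * lambda_min D)"
    using eq by (simp add: q_factor_def Let_def l_def[symmetric] K_def[symmetric])
qed

text \<open>\<open>cocoercive_weighted\<close> applies with constants \<open>\<mu>\<close> and
  \<open>L / l\<close>, since \<open>D \<preceq> I\<close> weakens the lower model and
  \<open>l I \<preceq> D\<close> the upper one. With \<open>W = D ** U\<close>, the bound by
  \<open>U \<bullet> W\<close> leaves a quadratic in \<open>\<gamma>\<close> to estimate.\<close>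

lemma gradient_step_contraction:
  fixes f :: "'m::finite \<Rightarrow> real ^ 'd::finite \<Rightarrow> real" and D :: "real ^ 'm ^ 'm"
  assumes mu: "0 < \<mu>"
    and strong: "\<And>i. strongly_convex \<mu> (f i)" and smooth: "\<And>i. smooth_with L (f i)"
    and D: "0 \<prec> D" "D \<preceq> mat 1"
    and gamma: "0 < \<gamma>" "\<gamma> \<le> gamma_star L \<mu> D"
    and W: "W = D ** (X - Z) - \<gamma> *\<^sub>R (stacked_gradient f X - stacked_gradient f Z)"
  shows "W \<bullet> W \<le> (q_factor L \<mu> D \<gamma>)\<^sup>2 * ((X - Z) \<bullet> (D ** (X - Z)))"
proof -
  define l where "l = lambda_min D"
  define K where "K = L + \<mu> * l"
  have muL: "\<mu> \<le> L" using strong_convexity_le_smoothness[OF strong smooth] .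
  have l: "0 < l" "l \<le> 1" using lambda_min_bounds[OF D] by (auto simp: l_def)
  then have K: "0 < K" using mu muL by (simp add: K_def add_pos_pos)
  have sym: "symmetric D" using D by (simp add: loewner_le_def)
  have posd: "0 < v \<bullet> (D *v v)" if "v \<noteq> 0" for v
    using D(1) that by (auto simp: loewner_less_def)
  then have nonneg: "0 \<le> v \<bullet> (D *v v)" for v by (cases "v = 0") (auto simp: less_imp_le)
  have le_one: "v \<bullet> (D *v v) \<le> 1 * (v \<bullet> (mat 1 *v v))" for v
    using D(2) by (simp add: loewner_le_def matrix_vector_mult_diff_rdistrib inner_diff_right)
  have ge_l: "v \<bullet> (mat 1 *v v) \<le> (1 / l) * (v \<bullet> (D *v v))" for v
    using lambda_min_symmetric(2)[OF sym, of v] l by (simp add: l_def field_simps)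
  define E where "E = matrix_inv D"
  have DE: "D ** (E ** U) = U" for U :: "real ^ 'd ^ 'm"
    using positive_definite_matrix_inv(1)[OF posd] by (simp add: matrix_mul_assoc E_def)
  define F G where "F X = (\<Sum>i\<in>UNIV. f i (X $ i))" and "G = stacked_gradient f" for X :: "real ^ 'd ^ 'm"
  have lower: "F U + G U \<bullet> (V - U) + \<mu> / 2 * ((V - U) \<bullet> (D ** (V - U))) \<le> F V" for U V
  proof -
    \<comment> \<open>Only the sum over rows is unfolded, by \<open>inner_vec_def\<close> at
      \<open>'m\<close>, so that the bounds for the single \<open>f i\<close> apply
      termwise.\<close>
    have "F U + G U \<bullet> (V - U) + \<mu> / 2 * ((V - U) \<bullet> (V - U)) = (\<Sum>i\<in>UNIV. f i (U $ i)
        + gradient (f i) (U $ i) \<bullet> (V $ i - U $ i) + \<mu> / 2 * ((V $ i - U $ i) \<bullet> (V $ i - U $ i)))"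
      by (simp add: F_def G_def stacked_gradient_def inner_vec_def[where 'b = 'm] sum.distrib sum_distrib_left)
    also have "\<dots> \<le> F V" unfolding F_def
      by (intro sum_mono strongly_convex_first_order strong smooth_with_GDERIV[OF smooth])
    finally have "F U + G U \<bullet> (V - U) + \<mu> / 2 * ((V - U) \<bullet> (V - U)) \<le> F V" .
    moreover have "\<mu> / 2 * ((V - U) \<bullet> (D ** (V - U))) \<le> \<mu> / 2 * ((V - U) \<bullet> (V - U))"
      using form_mono_matrix[OF le_one, of "V - U"] mu by (intro mult_left_mono) auto
    ultimately show ?thesis by linarith
  qed
  have upper: "F V \<le> F U + G U \<bullet> (V - U) + (L / l) / 2 * ((V - U) \<bullet> (D ** (V - U)))" for U V
  proof -
    have "F V \<le> (\<Sum>i\<in>UNIV. f i (U $ i)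
        + gradient (f i) (U $ i) \<bullet> (V $ i - U $ i) + L / 2 * ((V $ i - U $ i) \<bullet> (V $ i - U $ i)))"
      unfolding F_def by (intro sum_mono smooth_with_upper_bound smooth)
    also have "\<dots> = F U + G U \<bullet> (V - U) + L / 2 * ((V - U) \<bullet> (V - U))"
      by (simp add: F_def G_def stacked_gradient_def inner_vec_def[where 'b = 'm] sum.distrib sum_distrib_left)
    finally have "F V \<le> F U + G U \<bullet> (V - U) + L / 2 * ((V - U) \<bullet> (V - U))" .
    moreover have "L / 2 * ((V - U) \<bullet> (V - U)) \<le> L / 2 * ((1 / l) * ((V - U) \<bullet> (D ** (V - U))))"
      using form_mono_matrix[OF ge_l, of "V - U"] mu muL by (intro mult_left_mono) auto
    ultimately show ?thesis by simp
  qed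
  define d \<Delta> where "d = X - Z" and "\<Delta> = G X - G Z"
  define x r s where "x = d \<bullet> (D ** d)" and "r = d \<bullet> \<Delta>" and "s = \<Delta> \<bullet> (E ** \<Delta>)"
  have s: "0 \<le> s"
    using form_nonneg_matrix[OF nonneg, of "E ** \<Delta>"] by (simp add: s_def DE inner_commute)
  have "\<mu> * l \<le> L * 1" using mu muL l by (intro mult_mono) auto
  then have "\<mu> \<le> L / l" using l by (simp add: pos_le_divide_eq)
  then have "s + L / l * \<mu> * x \<le> (L / l + \<mu>) * r"
    unfolding s_def x_def r_def d_def \<Delta>_def
    by (intro cocoercive_weighted[where F = F] linear_matrix_mult_left symmetric_inner_matrix sym DE
        lower upper \<open>\<mu> \<le> L / l\<close>)
  then have "l * (s + L / l * \<mu> * x) \<le> l * ((L / l + \<mu>) * r)" using l by simp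
  moreover have "l * (s + L / l * \<mu> * x) = l * s + L * \<mu> * x"
    and "l * ((L / l + \<mu>) * r) = K * r"
    using l by (simp_all add: K_def field_simps)
  ultimately have co: "l * s + L * \<mu> * x \<le> K * r" by simp
  define U where "U = d - \<gamma> *\<^sub>R (E ** \<Delta>)"
  have DU: "D ** U = W"
    by (simp add: U_def W d_def \<Delta>_def G_def matrix_mult_left_linear_simps DE)
  have "W \<bullet> W \<le> U \<bullet> W"
    using contraction_in_square_form[OF D, of U] by (simp add: DU)
  also have "U \<bullet> W = x - 2 * \<gamma> * r + \<gamma>\<^sup>2 * s"
  proof -
    have "(E ** \<Delta>) \<bullet> (D ** d) = d \<bullet> \<Delta>"
      by (metis symmetric_inner_matrix[OF sym] DE inner_commute)
    then show ?thesis
      unfolding DU[symmetric]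
      by (simp add: U_def matrix_mult_left_linear_simps DE inner_diff x_def r_def s_def
          power2_eq_square algebra_simps inner_commute)
  qed
  also have "\<dots> \<le> (1 - 2 * \<gamma> * L * \<mu> / K) * x"
  proof -
    \<comment> \<open>The step-size bound trades \<open>K * \<gamma>\<^sup>2 * s\<close> for
      \<open>2 * \<gamma> * l * s\<close>; then \<open>co\<close> cancels the terms in
      \<open>r\<close>.\<close>
    have "\<gamma> * K \<le> 2 * l" using q_factor_sq(1)[OF D mu muL gamma] by (simp add: K_def l_def)
    then have "(\<gamma> * K) * (\<gamma> * s) \<le> (2 * l) * (\<gamma> * s)"
      using gamma s by (intro mult_right_mono) auto
    also have "\<dots> \<le> 2 * \<gamma> * (K * r - L * \<mu> * x)"
      using mult_left_mono[OF co, of "2 * \<gamma>"] gamma by (simp add: algebra_simps)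
    finally have "K * (x - 2 * \<gamma> * r + \<gamma>\<^sup>2 * s) \<le> K * x - 2 * \<gamma> * L * \<mu> * x"
      by (simp add: algebra_simps power2_eq_square)
    also have "\<dots> = K * ((1 - 2 * \<gamma> * L * \<mu> / K) * x)" using K by (simp add: field_simps)
    finally show ?thesis using K by simp
  qed
  also have "\<dots> = (q_factor L \<mu> D \<gamma>)\<^sup>2 * x"
    using q_factor_sq(2)[OF D mu muL gamma] by (simp add: K_def l_def)
  finally show ?thesis by (simp add: x_def d_def)
qed

lemma sum_gradient_at_minimizer:
  fixes f :: "'m::finite \<Rightarrow> real ^ 'd::finite \<Rightarrow> real"
  assumes smooth: "\<And>i. smooth_with L (f i)"
    and min: "is_arg_min (\<lambda>x. 1 / real CARD('m) * (\<Sum>i\<in>UNIV. f i x)) (\<lambda>_. True) x"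
  shows "(\<Sum>i\<in>UNIV. gradient (f i) x) = 0"
proof -
  let ?g = "\<Sum>i\<in>UNIV. gradient (f i) x"
  have "((\<lambda>x. \<Sum>i\<in>UNIV. f i x) has_derivative (\<lambda>h. \<Sum>i\<in>UNIV. h \<bullet> gradient (f i) x)) (at x)"
    using smooth_with_GDERIV[OF smooth] by (intro has_derivative_sum) (simp add: gderiv_def)
  moreover have "\<forall>y\<in>UNIV. (\<Sum>i\<in>UNIV. f i x) \<le> (\<Sum>i\<in>UNIV. f i y)"
    using min by (auto simp: is_arg_min_def not_less divide_le_cancel)
  ultimately have "(\<lambda>h. \<Sum>i\<in>UNIV. h \<bullet> gradient (f i) x) = (\<lambda>h. 0)"
    using differential_zero_maxmin[of x UNIV "\<lambda>x. \<Sum>i\<in>UNIV. f i x"] by auto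
  then have "?g \<bullet> ?g = 0" by (metis inner_sum_right)
  then show ?thesis by simp
qed

section \<open>Linear convergence\<close>

theorem theorem15:
  fixes f :: "'m::finite \<Rightarrow> real ^ 'd::finite \<Rightarrow> real"
    and \<mu> L \<gamma> \<delta> :: real
    and xstar :: "real ^ 'd"
    and A B C D :: "real ^ 'm ^ 'm"
    and X Y :: "nat \<Rightarrow> real ^ 'd ^ 'm"
  assumes m_ge_2: "CARD('m) \<ge> 2"
    and mu_pos: "\<mu> > 0"
    and strong: "\<And>i. strongly_convex \<mu> (f i)"
    and smooth: "\<And>i. smooth_with L (f i)"
    and xstar: "is_arg_min (\<lambda>x. 1 / real CARD('m) * (\<Sum>i\<in>UNIV. f i x)) (\<lambda>_. True) xstar"
    and B_sym: "symmetric B"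
    and C_sym: "symmetric C"
    and D_sym: "symmetric D"
    and A_eq: "A = B ** D"
    and D_bounds: "0 \<prec> D" "D \<preceq> mat 1"
    and D_ones: "1 \<bullet> (D *v 1) = real CARD('m)"
    and B_ones: "1 v* B = 1"
    and C_bounds: "0 \<preceq> C" "C \<prec> mat 1"
    and C_null: "null_space C = span {1}"
    and BC_commute: "B ** C = C ** B"
    and AB_less: "(q_factor L \<mu> D \<gamma>)\<^sup>2 *\<^sub>R (A ** B) \<prec> mat 1 - C"
    and gamma_bounds: "0 < \<gamma>" "\<gamma> \<le> gamma_star L \<mu> D"
    and Y_0: "Y 0 = 0"
    and X_Suc: "\<And>k. X (Suc k) = A ** X k - \<gamma> *\<^sub>R (B ** stacked_gradient f (X k)) - Y k"
    and Y_Suc: "\<And>k. Y (Suc k) = Y k + C ** X (Suc k)"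
    and delta: "\<delta> = max ((q_factor L \<mu> D \<gamma>)\<^sup>2 * lambda_max (A ** B ** matrix_inv (mat 1 - C)))
                        (1 - lambda_2 C)"
  shows "(\<lambda>k. (norm (X k - outer 1 xstar))\<^sup>2) \<in> O(\<lambda>k. \<delta> ^ k)"
proof -
  define Xs where "Xs = outer (1 :: real ^ 'm) xstar"
  define G where "G = stacked_gradient f"
  define M where "M = mat 1 - C"
  let ?q2 = "(q_factor L \<mu> D \<gamma>)\<^sup>2"
  have one_neq: "(1 :: real ^ 'm) \<noteq> 0" by (simp add: vec_eq_iff)

  \<comment> \<open>The consensus solution as a fixed point\<close>
  have D1: "D *v 1 = 1"
  proof -
    let ?N = "mat 1 - D"
    have N: "symmetric ?N" "\<And>v. 0 \<le> v \<bullet> (?N *v v)"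
      using D_bounds(2) by (auto simp: loewner_le_def symmetric_def transpose_def vec_eq_iff mat_def)
    \<comment> \<open>The normalisation of \<open>D\<close> makes the all-ones vector isotropic for
      the semidefinite \<open>mat 1 - D\<close>, which puts it in the kernel.\<close>
    have "1 \<bullet> (?N *v 1) = 0"
      using D_ones by (simp add: matrix_vector_mult_diff_rdistrib inner_diff_right inner_vec_def sum_subtractf)
    then have "u \<bullet> (?N *v 1) = 0" for u
      using form_radical[OF N(1) subspace_UNIV N(2)] by simp
    then have "?N *v 1 = 0" by (metis inner_eq_zero_iff)
    then show ?thesis by (simp add: matrix_vector_mult_diff_rdistrib)
  qed
  have B1: "B *v 1 = 1" using B_ones B_sym by (metis symmetric_def transpose_matrix_vector)
  have "1 \<in> null_space C" using C_null by (simp add: span_base)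
  then have C1: "C *v 1 = 0" by (simp add: null_space_def)
  have DXs: "D ** Xs = Xs" and BXs: "B ** Xs = Xs"
    by (simp_all add: Xs_def matrix_mult_outer D1 B1)
  have CXs: "C ** Xs = 0"
    by (simp add: Xs_def matrix_mult_outer C1) (simp add: outer_def vec_eq_iff)
  have GXs: "1 \<bullet> column j (\<gamma> *\<^sub>R G Xs) = 0" for j
  proof -
    have "1 \<bullet> column j (\<gamma> *\<^sub>R G Xs) = \<gamma> * ((\<Sum>i\<in>UNIV. gradient (f i) xstar) $ j)"
      by (simp add: inner_vec_def column_def G_def stacked_gradient_def Xs_def outer_def
          sum_distrib_left)
    then show ?thesis using sum_gradient_at_minimizer[OF smooth xstar] by simp
  qed
  then have "\<forall>j. \<exists>q. C *v q = column j (\<gamma> *\<^sub>R G Xs)"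
    using in_range_symmetric[OF C_sym C_null] by metis
  then obtain q where q: "\<And>j. C *v q j = column j (\<gamma> *\<^sub>R G Xs)" by metis
  \<comment> \<open>Assembled from columnwise preimages so that \<open>C ** Q0\<close> is the scaled
    gradient at \<open>Xs\<close>; this makes the representation of \<open>Y k\<close> proved below
    hold at \<open>Y 0 = 0\<close>.\<close>
  define Q0 :: "real ^ 'd ^ 'm" where "Q0 = (\<chi> i j. q j $ i)"
  have "column j (C ** Q0) = column j (\<gamma> *\<^sub>R G Xs)" for j
    using q[of j] by (simp add: column_matrix_mult) (simp add: column_def Q0_def)
  then have CQ0: "C ** Q0 = \<gamma> *\<^sub>R G Xs"
    by (simp add: column_def vec_eq_iff)

  \<comment> \<open>Error recursion in \<open>P\<close> and \<open>Q\<close>\<close>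
  define W where "W k = D ** (X k - Xs) - \<gamma> *\<^sub>R (G (X k) - G Xs)" for k
  txt \<open>\<open>B P\<^sub>k = X\<^sub>k\<^sub>+\<^sub>1 - X\<^sub>\<star>\<close>: the index of \<open>P\<close> lags by one because only the errors from
    \<open>k = 1\<close> on lie in the range of \<open>B\<close>.\<close>
  define Q where "Q = rec_nat Q0 (\<lambda>k R. R + (W k - C ** R))"
  define P where "P k = W k - C ** Q k" for k
  have Q_0: "Q 0 = Q0" and Q_Suc: "Q (Suc k) = Q k + P k" for k
    by (simp_all add: Q_def P_def)
  \<comment> \<open>Conditional on the form of \<open>Y k\<close>, because the induction
    establishing that form uses this identity in its own step.\<close>
  have X_of_Y: "X (Suc k) - Xs = B ** P k" if "Y k = B ** (C ** Q k) - \<gamma> *\<^sub>R (B ** G Xs)" for k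
    using that
    by (simp add: X_Suc A_eq P_def W_def G_def[symmetric] matrix_mult_left_linear_simps
        matrix_mul_assoc[symmetric] DXs BXs algebra_simps)
  have "Y k = B ** (C ** Q k) - \<gamma> *\<^sub>R (B ** G Xs)" for k
  proof (induction k)
    case 0
    show ?case by (simp add: Y_0 Q_0 CQ0 matrix_mult_left_linear_simps)
  next
    case (Suc k)
    have "Y (Suc k) = Y k + C ** (X (Suc k) - Xs)"
      by (simp add: Y_Suc matrix_mult_left_linear_simps CXs)
    \<comment> \<open>Commutation moves \<open>B\<close> to the front, which preserves the
      representation of \<open>Y\<close>.\<close>
    also have "\<dots> = Y k + B ** (C ** P k)"
      using X_of_Y[OF Suc] BC_commute by (simp add: matrix_mul_assoc)
    finally show ?case
      using Suc by (simp add: Q_Suc matrix_mult_left_linear_simps)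
  qed
  then have X_err: "X (Suc k) - Xs = B ** P k" for k
    by (rule X_of_Y)

  \<comment> \<open>Definiteness of the weights and positivity of the rate\<close>
  have M_sym: "symmetric M" and M_pos: "\<And>v. v \<noteq> 0 \<Longrightarrow> 0 < v \<bullet> (M *v v)"
    using C_bounds(2) C_sym
    by (auto simp: M_def loewner_less_def symmetric_def transpose_def vec_eq_iff mat_def)
  then have M_nonneg: "0 \<le> v \<bullet> (M *v v)" for v by (cases "v = 0") (auto simp: less_imp_le)
  have C_nonneg: "0 \<le> v \<bullet> (C *v v)" for v using C_bounds(1) by (simp add: loewner_le_def)
  have transpose: "transpose B = B" "transpose D = D"
    using B_sym D_sym by (auto simp: symmetric_def)
  have AB_sym: "symmetric (A ** B)" and BB_sym: "symmetric (B ** B)"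
    by (simp_all add: symmetric_def A_eq matrix_transpose_mul transpose matrix_mul_assoc)
  note l2 = lambda_2_form_le[OF m_ge_2 C_bounds(1) C_null one_neq]
  have delta_ge: "?q2 * lambda_max (A ** B ** matrix_inv M) \<le> \<delta>" "1 - lambda_2 C \<le> \<delta>"
    by (simp_all add: delta M_def)
  \<comment> \<open>\<open>C \<prec> I\<close> gives \<open>lambda_2 C < 1\<close>. Strict
    positivity matters because the index lag of \<open>P\<close> costs a division by
    \<open>\<delta>\<close> at the end.\<close>
  have delta_pos: "0 < \<delta>"
  proof -
    obtain v where v: "v \<noteq> 0" "C *v v = lambda_2 C *\<^sub>R v"
      using l2(1) by (auto simp: eigenvalues_def)
    have "0 < (1 - lambda_2 C) * (v \<bullet> v)"
      using M_pos[OF v(1)] by (simp add: M_def v(2) matrix_vector_mult_diff_rdistrib inner_diff_right algebra_simps)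
    then have "0 < 1 - lambda_2 C"
      by (rule zero_less_mult_pos2) (simp add: v(1))
    then show ?thesis using delta_ge by linarith
  qed

  \<comment> \<open>Contraction of the Lyapunov function\<close>
  define V where "V k = P k \<bullet> (M ** P k) + Q (Suc k) \<bullet> (C ** Q (Suc k))" for k
  have V_Suc: "V (Suc k) \<le> \<delta> * V k" for k
  proof -
    let ?W = "W (Suc k)" and ?Q = "Q (Suc k)"
    have MP: "M ** Z = Z - C ** Z" for Z :: "real ^ 'd ^ 'm"
      by (simp add: M_def matrix_matrix_mult_def mat_def vec_eq_iff sum_subtractf
          left_diff_distrib if_distrib[of "\<lambda>x. x * _"] cong: if_cong)
    have "?Q \<bullet> (C ** P (Suc k)) = P (Suc k) \<bullet> (C ** ?Q)"
      by (metis symmetric_inner_matrix[OF C_sym] inner_commute)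
    \<comment> \<open>The weight \<open>M = I - C\<close> cancels the term
      \<open>P (Suc k) \<bullet> (C ** P (Suc k))\<close> arising from
      \<open>Q (Suc (Suc k))\<close>.\<close>
    then have "V (Suc k) = P (Suc k) \<bullet> P (Suc k) + 2 * (P (Suc k) \<bullet> (C ** ?Q)) + ?Q \<bullet> (C ** ?Q)"
      by (simp add: V_def MP Q_Suc[of "Suc k"] matrix_mult_left_linear_simps
          inner_add_left inner_add_right inner_diff_right)
    \<comment> \<open>Adding and subtracting the square of \<open>C ** ?Q\<close> completes the
      square, as \<open>P (Suc k) + C ** ?Q = ?W\<close>.\<close>
    also have "\<dots> = ?W \<bullet> ?W + (?Q \<bullet> (C ** ?Q) - (C ** ?Q) \<bullet> (C ** ?Q))"
      unfolding P_def[of "Suc k"]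
      by (simp add: inner_diff_left inner_diff_right inner_commute)
    finally have V_eq: "V (Suc k) = ?W \<bullet> ?W + (?Q \<bullet> (C ** ?Q) - (C ** ?Q) \<bullet> (C ** ?Q))" .
    have "?W \<bullet> ?W \<le> ?q2 * ((X (Suc k) - Xs) \<bullet> (D ** (X (Suc k) - Xs)))"
      by (rule gradient_step_contraction[where f = f, OF mu_pos strong smooth D_bounds gamma_bounds])
        (simp add: W_def G_def)
    also have "(X (Suc k) - Xs) \<bullet> (D ** (X (Suc k) - Xs)) = P k \<bullet> ((A ** B) ** P k)"
      by (simp add: X_err A_eq symmetric_inner_matrix[OF B_sym] matrix_mul_assoc[symmetric])
    \<comment> \<open>The first entry of the maximum defining \<open>\<delta>\<close> controls the
      \<open>P\<close> part of \<open>V\<close>, the second entry below the \<open>Q\<close>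
      part.\<close>
    also have "?q2 * \<dots> \<le> ?q2 * (lambda_max (A ** B ** matrix_inv M) * (P k \<bullet> (M ** P k)))"
      by (intro mult_left_mono form_mono_matrix le_lambda_max_pencil AB_sym M_sym M_pos) auto
    also have "\<dots> \<le> \<delta> * (P k \<bullet> (M ** P k))"
      using mult_right_mono[OF delta_ge(1) form_nonneg_matrix[OF M_nonneg]]
      by (simp add: mult.assoc)
    finally have W_le: "?W \<bullet> ?W \<le> \<delta> * (P k \<bullet> (M ** P k))" .
    have "lambda_2 C * (?Q \<bullet> (C ** ?Q)) \<le> (C ** ?Q) \<bullet> (C ** ?Q)"
      unfolding inner_eq_sum_columns column_matrix_mult sum_distrib_left
      by (intro sum_mono l2(3))
    moreover have "(1 - lambda_2 C) * (?Q \<bullet> (C ** ?Q)) \<le> \<delta> * (?Q \<bullet> (C ** ?Q))"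
      using delta_ge(2) form_nonneg_matrix[OF C_nonneg] by (rule mult_right_mono)
    ultimately have "?Q \<bullet> (C ** ?Q) - (C ** ?Q) \<bullet> (C ** ?Q) \<le> \<delta> * (?Q \<bullet> (C ** ?Q))"
      by (simp add: left_diff_distrib)
    then show ?thesis using W_le V_eq by (simp add: V_def distrib_left)
  qed
  have V_le: "V k \<le> \<delta> ^ k * V 0" for k
  proof (induction k)
    case (Suc k)
    have "V (Suc k) \<le> \<delta> * V k" by (rule V_Suc)
    also have "\<dots> \<le> \<delta> * (\<delta> ^ k * V 0)" using Suc delta_pos by (intro mult_left_mono) auto
    finally show ?case by (simp add: mult.assoc)
  qed simp

  \<comment> \<open>From the Lyapunov function to the iterates\<close>
  define c where "c = \<bar>lambda_max (B ** B ** matrix_inv M)\<bar>"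
  have err: "(norm (X (Suc k) - Xs))\<^sup>2 \<le> c * (\<delta> ^ k * V 0)" for k
  proof -
    have "(norm (X (Suc k) - Xs))\<^sup>2 = P k \<bullet> ((B ** B) ** P k)"
      by (simp add: X_err power2_norm_eq_inner symmetric_inner_matrix[OF B_sym]
          matrix_mul_assoc[symmetric])
    also have "\<dots> \<le> lambda_max (B ** B ** matrix_inv M) * (P k \<bullet> (M ** P k))"
      by (intro form_mono_matrix le_lambda_max_pencil BB_sym M_sym M_pos)
    \<comment> \<open>Passing to the absolute value gives a nonnegative factor, so the later bounds
      on \<open>V\<close> can be multiplied by it.\<close>
    also have "\<dots> \<le> c * (P k \<bullet> (M ** P k))"
      unfolding c_def by (intro mult_right_mono form_nonneg_matrix M_nonneg) simp
    also have "\<dots> \<le> c * V k"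
      unfolding V_def c_def by (intro mult_left_mono) (simp_all add: form_nonneg_matrix C_nonneg)
    also have "\<dots> \<le> c * (\<delta> ^ k * V 0)"
      using V_le[of k] by (intro mult_left_mono) (auto simp: c_def)
    finally show ?thesis .
  qed
  \<comment> \<open>The initial error is arbitrary and need not lie in the range of
    \<open>B\<close>, so the estimate starts at \<open>k = 1\<close>; the shift contributes the
    factor \<open>1 / \<delta>\<close>.\<close>
  have "norm ((norm (X k - Xs))\<^sup>2) \<le> (c * V 0 / \<delta>) * norm (\<delta> ^ k)" if "k \<ge> 1" for k
  proof -
    obtain n where n: "k = Suc n" using \<open>k \<ge> 1\<close> by (cases k) auto
    have "c * (\<delta> ^ n * V 0) = (c * V 0 / \<delta>) * \<delta> ^ k" using delta_pos by (simp add: n)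
    then show ?thesis using err[of n] delta_pos by (simp add: n mult_ac)
  qed
  then have "(\<lambda>k. (norm (X k - Xs))\<^sup>2) \<in> O(\<lambda>k. \<delta> ^ k)"
    by (intro bigoI eventually_sequentiallyI)
  then show ?thesis by (simp add: Xs_def)
qed

end
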